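(* Let $P=\{p,q,r,s\}$ be a $4$-element set, let $\tau$ be the involution of $P$ exchanging $p$ and $q$ and fixing $r$ and $s$, and let $(P,\lhd,\diamond)$ be any of the nine qualgebras with operations \begin{align*} & x\lhd r=(x)\tau, && x\lhd y=x \ \text{ if } y\neq r,\\ & r\diamond r=s, && r\diamond x=x\diamond r=r\ \text{ if } x\neq r,\\ & s\diamond s=s, && q\diamond s=s\diamond q\in\{p,q,s\},\quad p\diamond s=s\diamond p=(q\diamond s)\tau,\\ & p\diamond q=q\diamond p=s, && q\diamond q\in\{p,q,s\},\quad p\diamond p=(q\diamond q)\tau \end{align*} (one for each choice of $q\diamond s$ and $q\diamond q$ in $\{p,q,s\}$). Then $B^2(P)\cong\mathbb{Z}^4$ and $H^2(P)\cong\mathbb{Z}/2\mathbb{Z}\oplus\mathbb{Z}^4$.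
   Context: For a qualgebra $(Q,\lhd,\diamond)$, a qualgebra $2$-cocycle is a pair of maps $\chi,\lambda\colon Q\times Q\to\mathbb{Z}$ such that for all $a,b,c\in Q$: $\chi(a,b)+\chi(a\lhd b,c)=\chi(a\lhd c,b\lhd c)+\chi(a,c)$; $\chi(a,a)=0$; $\chi(a,b\diamond c)=\chi(a,b)+\chi(a\lhd b,c)$; $\chi(a\diamond b,c)+\lambda(a\lhd c,b\lhd c)=\chi(a,c)+\chi(b,c)+\lambda(a,b)$; $\chi(a,b)+\lambda(a,b)=\lambda(b,a\lhd b)$. The $2$-cocycles form an Abelian group $Z^2(Q)$ under point-wise addition of both components. For a map $\varphi\colon Q\to\mathbb{Z}$, the qualgebra $2$-coboundary $(\chi_\varphi,\lambda_\varphi)$ is given by $\chi_\varphi(a,b)=\varphi(a\lhd b)-\varphi(a)$ and $\lambda_\varphi(a,b)=\varphi(a)+\varphi(b)-\varphi(a\diamond b)$. The set $B^2(Q)$ of all $2$-coboundaries is a subgroup of $Z^2(Q)$, and $H^2(Q)=Z^2(Q)/B^2(Q)$. *)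

theory Defs
  imports "HOL-Algebra.Algebra" "HOL-Combinatorics.Transposition"
begin

locale quandle =
  fixes act :: "'a \<Rightarrow> 'a \<Rightarrow> 'a"  (infixl "\<lhd>\<^sub>q" 70)
  assumes self_distrib: "(a \<lhd>\<^sub>q b) \<lhd>\<^sub>q c = (a \<lhd>\<^sub>q c) \<lhd>\<^sub>q (b \<lhd>\<^sub>q c)"
    and bij_translation: "bij (\<lambda>a. a \<lhd>\<^sub>q b)"
    and idem: "a \<lhd>\<^sub>q a = a"

locale qualgebra = quandle act
  for act :: "'a \<Rightarrow> 'a \<Rightarrow> 'a"  (infixl "\<lhd>\<^sub>q" 70) +
  fixes dia :: "'a \<Rightarrow> 'a \<Rightarrow> 'a"  (infixl "\<diamondop>\<^sub>q" 70)
  assumes act_dia: "a \<lhd>\<^sub>q (b \<diamondop>\<^sub>q c) = (a \<lhd>\<^sub>q b) \<lhd>\<^sub>q c"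
    and dia_act: "(a \<diamondop>\<^sub>q b) \<lhd>\<^sub>q c = (a \<lhd>\<^sub>q c) \<diamondop>\<^sub>q (b \<lhd>\<^sub>q c)"
    and semi_comm: "a \<diamondop>\<^sub>q b = b \<diamondop>\<^sub>q (a \<lhd>\<^sub>q b)"

text \<open>The definitions below take the two operations as bare arguments; they are meant to be applied
  to the operations of a qualgebra whose underlying set is the whole type.\<close>

definition is_qualgebra_cocycle ::
    "('a \<Rightarrow> 'a \<Rightarrow> 'a) \<Rightarrow> ('a \<Rightarrow> 'a \<Rightarrow> 'a) \<Rightarrow> ('a \<Rightarrow> 'a \<Rightarrow> int) \<Rightarrow> ('a \<Rightarrow> 'a \<Rightarrow> int) \<Rightarrow> bool"
  where "is_qualgebra_cocycle act dia \<chi> l \<longleftrightarrow>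
    (\<forall>a b c. \<chi> a b + \<chi> (act a b) c = \<chi> (act a c) (act b c) + \<chi> a c) \<and>
    (\<forall>a. \<chi> a a = 0) \<and>
    (\<forall>a b c. \<chi> a (dia b c) = \<chi> a b + \<chi> (act a b) c) \<and>
    (\<forall>a b c. \<chi> (dia a b) c + l (act a c) (act b c) = \<chi> a c + \<chi> b c + l a b) \<and>
    (\<forall>a b. \<chi> a b + l a b = l b (act a b))"

definition Z2 ::
    "('a \<Rightarrow> 'a \<Rightarrow> 'a) \<Rightarrow> ('a \<Rightarrow> 'a \<Rightarrow> 'a) \<Rightarrow> (('a \<Rightarrow> 'a \<Rightarrow> int) \<times> ('a \<Rightarrow> 'a \<Rightarrow> int)) monoid"
  where "Z2 act dia =
    \<lparr>carrier = {(\<chi>, l). is_qualgebra_cocycle act dia \<chi> l},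
     monoid.mult = (\<lambda>(\<chi>, l) (\<chi>', l'). (\<lambda>a b. \<chi> a b + \<chi>' a b, \<lambda>a b. l a b + l' a b)),
     one = (\<lambda>a b. 0, \<lambda>a b. 0)\<rparr>"

definition qualgebra_coboundary ::
    "('a \<Rightarrow> 'a \<Rightarrow> 'a) \<Rightarrow> ('a \<Rightarrow> 'a \<Rightarrow> 'a) \<Rightarrow> ('a \<Rightarrow> int) \<Rightarrow> ('a \<Rightarrow> 'a \<Rightarrow> int) \<times> ('a \<Rightarrow> 'a \<Rightarrow> int)"
  where "qualgebra_coboundary act dia \<phi> =
    (\<lambda>a b. \<phi> (act a b) - \<phi> a, \<lambda>a b. \<phi> a + \<phi> b - \<phi> (dia a b))"

definition B2 ::
    "('a \<Rightarrow> 'a \<Rightarrow> 'a) \<Rightarrow> ('a \<Rightarrow> 'a \<Rightarrow> 'a) \<Rightarrow> (('a \<Rightarrow> 'a \<Rightarrow> int) \<times> ('a \<Rightarrow> 'a \<Rightarrow> int)) monoid"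
  where "B2 act dia = (Z2 act dia)\<lparr>carrier := range (qualgebra_coboundary act dia)\<rparr>"

definition H2 ::
    "('a \<Rightarrow> 'a \<Rightarrow> 'a) \<Rightarrow> ('a \<Rightarrow> 'a \<Rightarrow> 'a) \<Rightarrow> (('a \<Rightarrow> 'a \<Rightarrow> int) \<times> ('a \<Rightarrow> 'a \<Rightarrow> int)) set monoid"
  where "H2 act dia = Z2 act dia Mod carrier (B2 act dia)"

definition Z_pow :: "nat \<Rightarrow> (nat \<Rightarrow> int) monoid"
  where "Z_pow n = product_group {..<n} (\<lambda>_. integer_group)"

lemma comm_group_Z2: "comm_group (Z2 act dia)"
proof (rule comm_groupI)
  fix x assume "x \<in> carrier (Z2 act dia)"
  then obtain f g where x: "x = (f, g)" "is_qualgebra_cocycle act dia f g"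
    by (auto simp: Z2_def)
  have "is_qualgebra_cocycle act dia (\<lambda>a b. - f a b) (\<lambda>a b. - g a b)"
    using x(2) unfolding is_qualgebra_cocycle_def by (simp add: algebra_simps)
  then show "\<exists>y\<in>carrier (Z2 act dia). y \<otimes>\<^bsub>Z2 act dia\<^esub> x = \<one>\<^bsub>Z2 act dia\<^esub>"
    by (intro bexI[of _ "(\<lambda>a b. - f a b, \<lambda>a b. - g a b)"]) (auto simp: x Z2_def)
next
  fix x y assume "x \<in> carrier (Z2 act dia)" "y \<in> carrier (Z2 act dia)"
  then show "x \<otimes>\<^bsub>Z2 act dia\<^esub> y \<in> carrier (Z2 act dia)"
    unfolding Z2_def is_qualgebra_cocycle_def by (auto simp: algebra_simps)
qed (auto simp: Z2_def is_qualgebra_cocycle_def fun_eq_iff split: prod.splits)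

lemma (in qualgebra) coboundary_is_cocycle:
  "qualgebra_coboundary act dia \<phi> \<in> carrier (Z2 act dia)"
  by (auto simp: Z2_def qualgebra_coboundary_def is_qualgebra_cocycle_def self_distrib[symmetric]
      idem act_dia dia_act semi_comm[symmetric])

lemma (in qualgebra) B2_subgroup: "subgroup (carrier (B2 act dia)) (Z2 act dia)"
proof -
  interpret Z: comm_group "Z2 act dia" by (rule comm_group_Z2)
  show ?thesis
  proof (rule Z.subgroupI)
    show "carrier (B2 act dia) \<subseteq> carrier (Z2 act dia)"
      using coboundary_is_cocycle by (auto simp: B2_def)
    show "carrier (B2 act dia) \<noteq> {}"
      by (auto simp: B2_def)
  next
    fix x assume "x \<in> carrier (B2 act dia)"
    then obtain \<phi> where x: "x = qualgebra_coboundary act dia \<phi>"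
      by (auto simp: B2_def)
    have "qualgebra_coboundary act dia (\<lambda>a. - \<phi> a) \<otimes>\<^bsub>Z2 act dia\<^esub> x = \<one>\<^bsub>Z2 act dia\<^esub>"
      by (simp add: x qualgebra_coboundary_def Z2_def)
    then have "inv\<^bsub>Z2 act dia\<^esub> x = qualgebra_coboundary act dia (\<lambda>a. - \<phi> a)"
      using coboundary_is_cocycle x by (intro Z.inv_equality) auto
    then show "inv\<^bsub>Z2 act dia\<^esub> x \<in> carrier (B2 act dia)"
      by (simp add: B2_def)
  next
    fix x y assume "x \<in> carrier (B2 act dia)" "y \<in> carrier (B2 act dia)"
    then obtain \<phi> \<psi> where "x = qualgebra_coboundary act dia \<phi>" "y = qualgebra_coboundary act dia \<psi>"
      by (auto simp: B2_def)
    then have "x \<otimes>\<^bsub>Z2 act dia\<^esub> y = qualgebra_coboundary act dia (\<lambda>a. \<phi> a + \<psi> a)"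
      by (auto simp: qualgebra_coboundary_def Z2_def fun_eq_iff)
    then show "x \<otimes>\<^bsub>Z2 act dia\<^esub> y \<in> carrier (B2 act dia)"
      by (simp add: B2_def)
  qed
qed

text \<open>The nine pairs of operations on a four-element type \<open>{p, q, r, s}\<close> do define qualgebras, so
  the facts above apply to them without the qualgebra axioms as an extra hypothesis.\<close>

lemma four_element_qualgebra:
  fixes p q r s :: 'a
    and act :: "'a \<Rightarrow> 'a \<Rightarrow> 'a"  (infixl "\<lhd>\<^sub>q" 70)
    and dia :: "'a \<Rightarrow> 'a \<Rightarrow> 'a"  (infixl "\<diamondop>\<^sub>q" 70)
    and \<tau> :: "'a \<Rightarrow> 'a"
  assumes P: "(UNIV :: 'a set) = {p, q, r, s}" "card {p, q, r, s} = 4"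
    and tau: "\<tau> = transpose p q"
    and act: "\<And>x. x \<lhd>\<^sub>q r = \<tau> x" "\<And>x y. y \<noteq> r \<Longrightarrow> x \<lhd>\<^sub>q y = x"
    and dia_r: "r \<diamondop>\<^sub>q r = s" "\<And>x. x \<noteq> r \<Longrightarrow> r \<diamondop>\<^sub>q x = r" "\<And>x. x \<noteq> r \<Longrightarrow> x \<diamondop>\<^sub>q r = r"
    and dia_s: "s \<diamondop>\<^sub>q s = s" "q \<diamondop>\<^sub>q s = s \<diamondop>\<^sub>q q" "q \<diamondop>\<^sub>q s \<in> {p, q, s}"
      "p \<diamondop>\<^sub>q s = s \<diamondop>\<^sub>q p" "p \<diamondop>\<^sub>q s = \<tau> (q \<diamondop>\<^sub>q s)"
    and dia_pq: "p \<diamondop>\<^sub>q q = q \<diamondop>\<^sub>q p" "p \<diamondop>\<^sub>q q = s"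
      "q \<diamondop>\<^sub>q q \<in> {p, q, s}" "p \<diamondop>\<^sub>q p = \<tau> (q \<diamondop>\<^sub>q q)"
  shows "qualgebra (\<lhd>\<^sub>q) (\<diamondop>\<^sub>q)"
proof -
  have ne: "p \<noteq> q" "p \<noteq> r" "p \<noteq> s" "q \<noteq> p" "q \<noteq> r" "q \<noteq> s"
      "r \<noteq> p" "r \<noteq> q" "r \<noteq> s" "s \<noteq> p" "s \<noteq> q" "s \<noteq> r"
    using P(2) by (auto simp: card_insert_if split: if_splits)
  have t: "\<tau> p = q" "\<tau> q = p" "\<tau> r = r" "\<tau> s = s"
    using ne by (auto simp: tau)
  have ex: "(\<forall>x. Q x) \<longleftrightarrow> Q p \<and> Q q \<and> Q r \<and> Q s" for Q :: "'a \<Rightarrow> bool"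
    using P(1) by (metis UNIV_I empty_iff insert_iff)
  note a = act t ne
  note d = dia_r dia_s(1) dia_s(2)[symmetric] dia_s(4)[symmetric] dia_s(5)
    dia_pq(1)[symmetric] dia_pq(2,4)
  have "\<forall>a b c. (a \<lhd>\<^sub>q b) \<lhd>\<^sub>q c = (a \<lhd>\<^sub>q c) \<lhd>\<^sub>q (b \<lhd>\<^sub>q c)"
    unfolding ex by (simp add: a)
  moreover have "bij (\<lambda>a. a \<lhd>\<^sub>q b)" for b
    by (cases "b = r") (auto simp: act tau bij_id[unfolded id_def])
  moreover have "\<forall>a. a \<lhd>\<^sub>q a = a"
    unfolding ex by (simp add: a)
  moreover have "\<forall>a b c. a \<lhd>\<^sub>q (b \<diamondop>\<^sub>q c) = (a \<lhd>\<^sub>q b) \<lhd>\<^sub>q c"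
    using dia_s(3) dia_pq(3) unfolding ex by (elim insertE emptyE) (simp_all add: a d)
  moreover have "\<forall>a b c. (a \<diamondop>\<^sub>q b) \<lhd>\<^sub>q c = (a \<lhd>\<^sub>q c) \<diamondop>\<^sub>q (b \<lhd>\<^sub>q c)"
    using dia_s(3) dia_pq(3) unfolding ex by (elim insertE emptyE) (simp_all add: a d)
  moreover have "\<forall>a b. a \<diamondop>\<^sub>q b = b \<diamondop>\<^sub>q (a \<lhd>\<^sub>q b)"
    using dia_s(3) dia_pq(3) unfolding ex by (elim insertE emptyE) (simp_all add: a d)
  ultimately show ?thesis
    by unfold_locales blast+
qed

end

theory Submission
  imports Defs
begin

text \<open>
  A cocycle \<open>(\<chi>, l)\<close> on one of these qualgebras almost remembers a function that could have
  it as coboundary.  Since \<open>a \<diamondop> r = r\<close> for \<open>a \<noteq> r\<close>, the coboundary of \<open>\<phi>\<close> has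
  \<open>\<lambda>\<^sub>\<phi> a r = \<phi> a\<close> there, and since \<open>s \<diamondop> s = s\<close> it has \<open>\<lambda>\<^sub>\<phi> s s = \<phi> s\<close>; so \<open>\<phi>\<close> can be
  read off at \<open>p\<close>, \<open>q\<close> and \<open>s\<close>.  The value at \<open>r\<close> is
  visible only through \<open>\<lambda>\<^sub>\<phi> r r = 2 * \<phi> r - \<phi> s\<close>, that is, doubled.  Doubling is
  injective on \<open>\<int>\<close>, so the coboundary map is injective and \<open>B\<^sup>2 \<cong> \<int>\<^sup>4\<close>; it is not surjective, and
  this is the source of the torsion in \<open>H\<^sup>2\<close>.

  For an arbitrary cocycle, let \<open>pot l\<close> be the function read off from \<open>l\<close> in this way, with value 0
  at \<open>r\<close>.  Subtracting its coboundary kills \<open>\<chi>\<close> (lemma \<open>chi_eq_pot\<close>) and leaves the \<open>defect\<close>, the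
  second component of a cocycle \<open>(0, m)\<close>.  For \<open>\<chi> = 0\<close> the cocycle equations
  only say that \<open>m\<close> is symmetric and invariant under \<open>\<tau>\<close> (lemma \<open>cocycle_zero_iff\<close>), whichever of
  the nine products is taken.  As \<open>m\<close> vanishes on \<open>(p, r)\<close>, \<open>(q, r)\<close> and \<open>(s, s)\<close>, there remain five
  free integers: \<open>m p p\<close>, \<open>m p q\<close>, \<open>m p s\<close>, \<open>m r s\<close> and \<open>m r r\<close>.  Coboundaries have defect zero
  except for \<open>m r r\<close>, which is an arbitrary even number.  Hence the first four integers and the
  parity of \<open>m r r\<close> define a surjection \<open>Z\<^sup>2 \<rightarrow> \<int>/2 \<oplus> \<int>\<^sup>4\<close> with kernel \<open>B\<^sup>2\<close>.
\<close>

locale swap_qualgebra =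
  fixes p q r s :: 'a
    and act :: "'a \<Rightarrow> 'a \<Rightarrow> 'a"  (infixl "\<lhd>\<^sub>q" 70)
    and dia :: "'a \<Rightarrow> 'a \<Rightarrow> 'a"  (infixl "\<diamondop>\<^sub>q" 70)
    and \<tau> :: "'a \<Rightarrow> 'a"
  assumes elements: "(UNIV :: 'a set) = {p, q, r, s}" "card {p, q, r, s} = 4"
    and tau: "\<tau> = transpose p q"
    and act: "\<And>x. x \<lhd>\<^sub>q r = \<tau> x" "\<And>x y. y \<noteq> r \<Longrightarrow> x \<lhd>\<^sub>q y = x"
    and dia_r: "r \<diamondop>\<^sub>q r = s" "\<And>x. x \<noteq> r \<Longrightarrow> r \<diamondop>\<^sub>q x = r" "\<And>x. x \<noteq> r \<Longrightarrow> x \<diamondop>\<^sub>q r = r"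
    and dia_s: "s \<diamondop>\<^sub>q s = s" "q \<diamondop>\<^sub>q s = s \<diamondop>\<^sub>q q" "q \<diamondop>\<^sub>q s \<in> {p, q, s}"
      "p \<diamondop>\<^sub>q s = s \<diamondop>\<^sub>q p" "p \<diamondop>\<^sub>q s = \<tau> (q \<diamondop>\<^sub>q s)"
    and dia_pq: "p \<diamondop>\<^sub>q q = q \<diamondop>\<^sub>q p" "p \<diamondop>\<^sub>q q = s"
      "q \<diamondop>\<^sub>q q \<in> {p, q, s}" "p \<diamondop>\<^sub>q p = \<tau> (q \<diamondop>\<^sub>q q)"
begin

sublocale qualgebra act dia
  by (rule four_element_qualgebra[where p = p and q = q and r = r and s = s and \<tau> = \<tau>])
    (fact elements tau act dia_r dia_s dia_pq)+

lemma distinct_elements [simp]: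
  "p \<noteq> q" "p \<noteq> r" "p \<noteq> s" "q \<noteq> p" "q \<noteq> r" "q \<noteq> s"
  "r \<noteq> p" "r \<noteq> q" "r \<noteq> s" "s \<noteq> p" "s \<noteq> q" "s \<noteq> r"
  using elements(2) by (auto simp: card_insert_if split: if_splits)

lemma all_elements: "(\<forall>x. Q x) \<longleftrightarrow> Q p \<and> Q q \<and> Q r \<and> Q s" for Q :: "'a \<Rightarrow> bool"
  using elements(1) by (metis UNIV_I empty_iff insert_iff)

lemma tau_simps [simp]: "\<tau> p = q" "\<tau> q = p" "\<tau> r = r" "\<tau> s = s"
  by (auto simp: tau)

lemma dia_r_simps [simp]: "p \<diamondop>\<^sub>q r = r" "q \<diamondop>\<^sub>q r = r" "s \<diamondop>\<^sub>q r = r"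
  "r \<diamondop>\<^sub>q p = r" "r \<diamondop>\<^sub>q q = r" "r \<diamondop>\<^sub>q s = r" "r \<diamondop>\<^sub>q r = s"
  by (simp_all add: dia_r)

lemma dia_simps [simp]: "s \<diamondop>\<^sub>q s = s" "p \<diamondop>\<^sub>q q = s" "q \<diamondop>\<^sub>q p = s"
  by (simp_all add: dia_s(1) dia_pq(2) dia_pq(1)[symmetric])

text \<open>The translation by \<open>a \<diamondop> b\<close> is the composition of those by \<open>a\<close> and \<open>b\<close>, and \<open>r\<close> is the only element
  whose translation moves anything.\<close>

lemma dia_eq_r_iff: "a \<diamondop>\<^sub>q b = r \<longleftrightarrow> (a = r) \<noteq> (b = r)"
proof -
  have r_iff: "x = r \<longleftrightarrow> p \<lhd>\<^sub>q x \<noteq> p" for x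
    by (cases "x = r") (simp_all add: act)
  show ?thesis
    unfolding r_iff[of "a \<diamondop>\<^sub>q b"] act_dia by (cases "a = r"; cases "b = r") (simp_all add: act)
qed


section \<open>The two components of a cocycle\<close>

lemma cocycle_chi_eq_0:
  assumes "is_qualgebra_cocycle (\<lhd>\<^sub>q) (\<diamondop>\<^sub>q) \<chi> l" "b \<noteq> r"
  shows "\<chi> a b = 0"
proof -
  \<comment> \<open>Multiplying \<open>r\<close> by \<open>b\<close> does not change it, so \<open>b\<close> contributes nothing to \<open>\<chi> x\<close> at \<open>r \<diamondop> b = r\<close>;
      every \<open>a\<close> has the form \<open>x \<lhd> r\<close>.\<close>
  have "\<chi> x (r \<diamondop>\<^sub>q b) = \<chi> x r + \<chi> (\<tau> x) b" for x
    using assms(1) by (simp add: is_qualgebra_cocycle_def act)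
  from this[of "\<tau> a"] show ?thesis
    using assms(2) by (simp add: dia_r tau)
qed

text \<open>Since \<open>r \<diamondop> r = s\<close>, acting twice by \<open>r\<close> has the weight of acting by \<open>s\<close>, which is zero.\<close>

lemma cocycle_chi_r:
  assumes "is_qualgebra_cocycle (\<lhd>\<^sub>q) (\<diamondop>\<^sub>q) \<chi> l"
  shows "\<chi> a r + \<chi> (\<tau> a) r = 0"
proof -
  have "\<chi> a (r \<diamondop>\<^sub>q r) = \<chi> a r + \<chi> (a \<lhd>\<^sub>q r) r"
    using assms unfolding is_qualgebra_cocycle_def by blast
  then show ?thesis
    using cocycle_chi_eq_0[OF assms, of s a] by (simp add: act)
qed

text \<open>For \<open>\<chi> = 0\<close> the equations that involve products lose their product terms.  Semi-commutativity
  reads \<open>m a b = m b a\<close> unless \<open>b = r\<close>, when it reads \<open>m a r = m r (\<tau> a)\<close>; the two agree because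
  \<open>m\<close> is invariant and \<open>\<tau> r = r\<close>.\<close>

lemma cocycle_zero_iff:
  "is_qualgebra_cocycle (\<lhd>\<^sub>q) (\<diamondop>\<^sub>q) (\<lambda>a b. 0) m \<longleftrightarrow>
    (\<forall>a b. m a b = m b a) \<and> (\<forall>a b. m (\<tau> a) (\<tau> b) = m a b)"
proof
  assume "is_qualgebra_cocycle (\<lhd>\<^sub>q) (\<diamondop>\<^sub>q) (\<lambda>a b. 0) m"
  then have inv: "m (a \<lhd>\<^sub>q c) (b \<lhd>\<^sub>q c) = m a b" and semi: "m a b = m b (a \<lhd>\<^sub>q b)" for a b c
    unfolding is_qualgebra_cocycle_def by simp_all
  have comm: "m a b = m b a" if "b \<noteq> r" for a b
    using semi[of a b] that by (simp add: act)
  have "m a b = m b a" for a b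
    using comm[of a b] comm[of b a] by fastforce
  then show "(\<forall>a b. m a b = m b a) \<and> (\<forall>a b. m (\<tau> a) (\<tau> b) = m a b)"
    using inv[of _ r] by (simp add: act)
next
  assume "(\<forall>a b. m a b = m b a) \<and> (\<forall>a b. m (\<tau> a) (\<tau> b) = m a b)"
  then have comm: "m a b = m b a" and inv: "m (\<tau> a) (\<tau> b) = m a b" for a b
    by blast+
  have "m (a \<lhd>\<^sub>q c) (b \<lhd>\<^sub>q c) = m a b" for a b c
    by (cases "c = r") (simp_all add: act inv)
  moreover have "m b (a \<lhd>\<^sub>q b) = m a b" for a b
  proof (cases "b = r")
    case True
    have "m r (\<tau> a) = m (\<tau> r) (\<tau> a)" by simp
    also have "\<dots> = m a r" unfolding inv by (rule comm)
    finally show ?thesis by (simp add: True act)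
  next
    case False
    then show ?thesis by (simp add: act comm[of b a])
  qed
  ultimately show "is_qualgebra_cocycle (\<lhd>\<^sub>q) (\<diamondop>\<^sub>q) (\<lambda>a b. 0) m"
    unfolding is_qualgebra_cocycle_def by simp
qed


section \<open>Subtracting a coboundary\<close>

text \<open>If \<open>l\<close> is the second component of the coboundary of \<open>\<phi>\<close>, then \<open>pot l\<close> is \<open>\<phi>\<close> with its value
  at \<open>r\<close> replaced by 0.  The value itself satisfies \<open>2 * \<phi> r = l r r + l s s\<close>, and
  the right-hand side can be odd for a cocycle, so there is no integer to read off at \<open>r\<close>.\<close>

definition pot :: "('a \<Rightarrow> 'a \<Rightarrow> int) \<Rightarrow> 'a \<Rightarrow> int"
  where "pot l a = (if a = r then 0 else if a = s then l s s else l a r)"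

definition defect :: "('a \<Rightarrow> 'a \<Rightarrow> int) \<Rightarrow> 'a \<Rightarrow> 'a \<Rightarrow> int"
  where "defect l a b = l a b - (pot l a + pot l b - pot l (a \<diamondop>\<^sub>q b))"

lemma pot_simps [simp]: "pot l p = l p r" "pot l q = l q r" "pot l r = 0" "pot l s = l s s"
  by (simp_all add: pot_def)

lemma pot_add: "pot (\<lambda>a b. l a b + l' a b) a = pot l a + pot l' a"
  by (simp add: pot_def)

lemma defect_add: "defect (\<lambda>a b. l a b + l' a b) a b = defect l a b + defect l' a b"
  by (simp add: defect_def pot_add)

text \<open>\<open>\<chi>\<close> vanishes except possibly at \<open>(p, r)\<close> and \<open>(q, r)\<close>; the last cocycle
  equation at \<open>(p, r)\<close> and at \<open>(r, q)\<close> gives \<open>\<chi> p r + l p r = l r q = l q r\<close>.\<close>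

lemma chi_eq_pot:
  assumes c: "is_qualgebra_cocycle (\<lhd>\<^sub>q) (\<diamondop>\<^sub>q) \<chi> l"
  shows "\<chi> = (\<lambda>a b. pot l (a \<lhd>\<^sub>q b) - pot l a)"
proof -
  have semi: "\<chi> a b + l a b = l b (a \<lhd>\<^sub>q b)" for a b
    using c unfolding is_qualgebra_cocycle_def by blast
  have "l r q = l q r"
    using semi[of r q] cocycle_chi_eq_0[OF c, of q r] by (simp add: act)
  with semi[of p r] have "\<chi> p r = l q r - l p r"
    by (simp add: act)
  then have "\<forall>a b. \<chi> a b = pot l (a \<lhd>\<^sub>q b) - pot l a"
    using cocycle_chi_r[OF c, of p] cocycle_chi_r[OF c, of r] cocycle_chi_r[OF c, of s]
    unfolding all_elements by (simp add: act cocycle_chi_eq_0[OF c])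
  then show ?thesis by (simp add: fun_eq_iff)
qed

text \<open>Both \<open>(\<chi>, l)\<close> and the coboundary of \<open>pot l\<close> are cocycles, and their first components agree.\<close>

lemma defect_cocycle:
  assumes c: "is_qualgebra_cocycle (\<lhd>\<^sub>q) (\<diamondop>\<^sub>q) \<chi> l"
  shows "is_qualgebra_cocycle (\<lhd>\<^sub>q) (\<diamondop>\<^sub>q) (\<lambda>a b. 0) (defect l)"
proof -
  have chi: "\<chi> a b = pot l (a \<lhd>\<^sub>q b) - pot l a" for a b
    by (subst chi_eq_pot[OF c]) simp
  have l: "\<chi> (a \<diamondop>\<^sub>q b) c + l (a \<lhd>\<^sub>q c) (b \<lhd>\<^sub>q c) = \<chi> a c + \<chi> b c + l a b"
      "\<chi> a b + l a b = l b (a \<lhd>\<^sub>q b)" for a b c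
    using c unfolding is_qualgebra_cocycle_def by blast+
  show ?thesis
    unfolding is_qualgebra_cocycle_def defect_def
    using l[unfolded chi] by (auto simp: dia_act semi_comm[symmetric] algebra_simps)
qed

lemma pot_coboundary:
  "pot (\<lambda>a b. \<phi> a + \<phi> b - \<phi> (a \<diamondop>\<^sub>q b)) a = (if a = r then 0 else \<phi> a)"
proof -
  have "\<forall>a. pot (\<lambda>a b. \<phi> a + \<phi> b - \<phi> (a \<diamondop>\<^sub>q b)) a = (if a = r then 0 else \<phi> a)"
    unfolding all_elements by simp
  then show ?thesis by blast
qed

text \<open>The contributions of \<open>\<phi> r\<close> cancel in \<open>\<phi> a + \<phi> b - \<phi> (a \<diamondop> b)\<close> except at \<open>(r, r)\<close>: a product with
  exactly one factor \<open>r\<close> equals \<open>r\<close>, and every other product differs from \<open>r\<close>.\<close>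

lemma defect_coboundary:
  "defect (\<lambda>a b. \<phi> a + \<phi> b - \<phi> (a \<diamondop>\<^sub>q b)) a b = (if a = r \<and> b = r then 2 * \<phi> r else 0)"
  by (auto simp: defect_def pot_coboundary dia_eq_r_iff dia_r(2,3))


section \<open>Coboundaries\<close>

lemma inj_coboundary: "inj (qualgebra_coboundary (\<lhd>\<^sub>q) (\<diamondop>\<^sub>q))"
proof (rule injI)
  fix \<phi> \<psi> :: "'a \<Rightarrow> int"
  assume "qualgebra_coboundary (\<lhd>\<^sub>q) (\<diamondop>\<^sub>q) \<phi> = qualgebra_coboundary (\<lhd>\<^sub>q) (\<diamondop>\<^sub>q) \<psi>"
  then have eq: "(\<lambda>a b. \<phi> a + \<phi> b - \<phi> (a \<diamondop>\<^sub>q b)) = (\<lambda>a b. \<psi> a + \<psi> b - \<psi> (a \<diamondop>\<^sub>q b))"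
    by (simp add: qualgebra_coboundary_def)
  have "\<phi> r = \<psi> r"
    using defect_coboundary[of \<phi> r r] defect_coboundary[of \<psi> r r] unfolding eq by simp
  moreover have "\<phi> a = \<psi> a" if "a \<noteq> r" for a
    using pot_coboundary[of \<phi> a] pot_coboundary[of \<psi> a] that unfolding eq by simp
  ultimately show "\<phi> = \<psi>" by (metis ext)
qed

definition index :: "'a \<Rightarrow> nat"
  where "index a = (if a = p then 0 else if a = q then 1 else if a = r then 2 else 3)"

lemma bij_index: "bij_betw index UNIV {..<4}"
  unfolding bij_betw_def
proof
  show "inj index"
    unfolding inj_def all_elements by (simp add: index_def)
  show "index ` UNIV = {..<4}"
    unfolding elements(1) by (auto simp: index_def)
qed

lemma B2_iso: "B2 (\<lhd>\<^sub>q) (\<diamondop>\<^sub>q) \<cong> Z_pow 4"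
proof -
  define h where "h f = qualgebra_coboundary (\<lhd>\<^sub>q) (\<diamondop>\<^sub>q) (\<lambda>a. f (index a))" for f
  have grp: "group (Z_pow 4)"
    by (simp add: Z_pow_def)
  have lt: "index a < 4" for a
    by (simp add: index_def)
  have "h \<in> hom (Z_pow 4) (B2 (\<lhd>\<^sub>q) (\<diamondop>\<^sub>q))"
  proof (rule homI)
    show "h f \<in> carrier (B2 (\<lhd>\<^sub>q) (\<diamondop>\<^sub>q))" for f
      by (simp add: h_def B2_def)
    show "h (f \<otimes>\<^bsub>Z_pow 4\<^esub> g) = h f \<otimes>\<^bsub>B2 (\<lhd>\<^sub>q) (\<diamondop>\<^sub>q)\<^esub> h g" for f g
      by (simp add: h_def B2_def Z2_def Z_pow_def qualgebra_coboundary_def fun_eq_iff lt)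
  qed
  moreover have "inj_on h (carrier (Z_pow 4))"
  proof (rule inj_onI)
    fix f g assume fg: "f \<in> carrier (Z_pow 4)" "g \<in> carrier (Z_pow 4)" and "h f = h g"
    then have "f (index a) = g (index a)" for a
      using injD[OF inj_coboundary] unfolding h_def by metis
    then have "f i = g i" if "i < 4" for i
      using bij_index that unfolding bij_betw_def by (metis imageE lessThan_iff)
    then show "f = g"
      using fg by (intro PiE_ext[of f "{..<4}" "\<lambda>_. UNIV" g]) (auto simp: Z_pow_def)
  qed
  moreover have "h ` carrier (Z_pow 4) = carrier (B2 (\<lhd>\<^sub>q) (\<diamondop>\<^sub>q))"
  proof
    show "h ` carrier (Z_pow 4) \<subseteq> carrier (B2 (\<lhd>\<^sub>q) (\<diamondop>\<^sub>q))"
      by (auto simp: h_def B2_def)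
    show "carrier (B2 (\<lhd>\<^sub>q) (\<diamondop>\<^sub>q)) \<subseteq> h ` carrier (Z_pow 4)"
    proof
      fix x assume "x \<in> carrier (B2 (\<lhd>\<^sub>q) (\<diamondop>\<^sub>q))"
      then obtain \<phi> where x: "x = qualgebra_coboundary (\<lhd>\<^sub>q) (\<diamondop>\<^sub>q) \<phi>"
        by (auto simp: B2_def)
      have "h (\<lambda>i\<in>{..<4}. \<phi> (inv_into UNIV index i)) = x"
        using bij_betw_imp_inj_on[OF bij_index] by (simp add: h_def x lt)
      moreover have "(\<lambda>i\<in>{..<4}. \<phi> (inv_into UNIV index i)) \<in> carrier (Z_pow 4)"
        by (simp add: Z_pow_def)
      ultimately show "x \<in> h ` carrier (Z_pow 4)"
        by blast
    qed
  qed
  ultimately have "h \<in> iso (Z_pow 4) (B2 (\<lhd>\<^sub>q) (\<diamondop>\<^sub>q))"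
    by (simp add: iso_def bij_betw_def)
  then show ?thesis
    using group.iso_sym[OF grp] is_isoI by blast
qed


section \<open>The second cohomology group\<close>

definition invariants :: "('a \<Rightarrow> 'a \<Rightarrow> int) \<Rightarrow> int \<times> (nat \<Rightarrow> int)"
  where "invariants m = (m r r mod 2, \<lambda>i\<in>{..<4}. [m p p, m p q, m p s, m r s] ! i)"

lemma invariants_eq_iff:
  "invariants m = (e, \<lambda>i\<in>{..<4}. f i) \<longleftrightarrow>
    m r r mod 2 = e \<and> m p p = f 0 \<and> m p q = f 1 \<and> m p s = f 2 \<and> m r s = f 3"
  unfolding invariants_def by (auto simp: fun_eq_iff restrict_def numeral_eq_Suc less_Suc_eq)

lemma one_Z_pow: "\<one>\<^bsub>Z_pow 4\<^esub> = (\<lambda>i\<in>{..<4}. 0)"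
  by (simp add: Z_pow_def)

lemma invariants_hom:
  "(\<lambda>c. invariants (defect (snd c)))
    \<in> hom (Z2 (\<lhd>\<^sub>q) (\<diamondop>\<^sub>q)) (integer_mod_group 2 \<times>\<times> Z_pow 4)"
proof (rule homI)
  show "invariants (defect (snd x)) \<in> carrier (integer_mod_group 2 \<times>\<times> Z_pow 4)"
    for x :: "('a \<Rightarrow> 'a \<Rightarrow> int) \<times> ('a \<Rightarrow> 'a \<Rightarrow> int)"
    by (simp add: invariants_def Z_pow_def carrier_integer_mod_group)
  fix x y assume "x \<in> carrier (Z2 (\<lhd>\<^sub>q) (\<diamondop>\<^sub>q))" "y \<in> carrier (Z2 (\<lhd>\<^sub>q) (\<diamondop>\<^sub>q))"
  have snd_mult: "snd (x \<otimes>\<^bsub>Z2 (\<lhd>\<^sub>q) (\<diamondop>\<^sub>q)\<^esub> y) = (\<lambda>a b. snd x a b + snd y a b)"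
    by (cases x; cases y) (simp add: Z2_def)
  show "invariants (defect (snd (x \<otimes>\<^bsub>Z2 (\<lhd>\<^sub>q) (\<diamondop>\<^sub>q)\<^esub> y))) =
      invariants (defect (snd x)) \<otimes>\<^bsub>integer_mod_group 2 \<times>\<times> Z_pow 4\<^esub> invariants (defect (snd y))"
    unfolding snd_mult
    by (auto simp: invariants_def defect_add Z_pow_def mult_integer_mod_group mod_add_eq
        fun_eq_iff restrict_def numeral_eq_Suc less_Suc_eq)
qed

text \<open>Every symmetric \<open>\<tau>\<close>-invariant \<open>m\<close> that vanishes on \<open>(p, r)\<close>, \<open>(q, r)\<close> and \<open>(s, s)\<close> is its own
  defect, so the five integers can be prescribed by a table with \<open>\<chi> = 0\<close>.\<close>

lemma invariants_surj:
  assumes "y \<in> carrier (integer_mod_group 2 \<times>\<times> Z_pow 4)"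
  shows "y \<in> (\<lambda>c. invariants (defect (snd c))) ` carrier (Z2 (\<lhd>\<^sub>q) (\<diamondop>\<^sub>q))"
proof -
  obtain e f where y: "y = (e, f)" by (cases y)
  have e: "e mod 2 = e"
    using assms by (simp add: y carrier_integer_mod_group)
  have "f \<in> {..<4} \<rightarrow>\<^sub>E UNIV"
    using assms by (simp add: y Z_pow_def)
  then have f: "f = (\<lambda>i\<in>{..<4}. f i)"
    by (rule PiE_restrict[symmetric])
  define m where "m a b =
    (if a = r \<and> b = r then e
     else if a = r \<or> b = r then if a = s \<or> b = s then f 3 else 0
     else if a = s \<and> b = s then 0
     else if a = s \<or> b = s then f 2
     else if a = b then f 0 else f 1)" for a b
  have "is_qualgebra_cocycle (\<lhd>\<^sub>q) (\<diamondop>\<^sub>q) (\<lambda>a b. 0) m"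
    unfolding cocycle_zero_iff all_elements by (simp add: m_def)
  then have mem: "(\<lambda>a b. 0, m) \<in> carrier (Z2 (\<lhd>\<^sub>q) (\<diamondop>\<^sub>q))"
    by (simp add: Z2_def)
  have "m p r = 0" "m q r = 0" "m s s = 0"
    by (simp_all add: m_def)
  then have "\<forall>a. pot m a = 0"
    unfolding all_elements by simp
  then have "defect m = m"
    by (simp add: defect_def fun_eq_iff)
  moreover have "invariants m = (e, \<lambda>i\<in>{..<4}. f i)"
    unfolding invariants_eq_iff by (simp add: m_def e)
  ultimately have "invariants (defect (snd (\<lambda>a b. 0 :: int, m))) = y"
    using f[symmetric] y by simp
  then show ?thesis
    by (intro image_eqI[OF _ mem]) simp
qed

text \<open>If the invariants of a cocycle vanish, its defect is an even number \<open>2 * k\<close> at \<open>(r, r)\<close> and zero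
  elsewhere, which is the coboundary of \<open>k\<close> times the indicator function of \<open>r\<close>.\<close>

lemma coboundary_if_invariants_trivial:
  assumes c: "is_qualgebra_cocycle (\<lhd>\<^sub>q) (\<diamondop>\<^sub>q) \<chi> l"
    and triv: "invariants (defect l) = (0, \<lambda>i\<in>{..<4}. 0)"
  shows "(\<chi>, l) \<in> range (qualgebra_coboundary (\<lhd>\<^sub>q) (\<diamondop>\<^sub>q))"
proof -
  define m where "m = defect l"
  from triv have m: "m r r mod 2 = 0" "m p p = 0" "m p q = 0" "m p s = 0" "m r s = 0"
    using invariants_eq_iff[of m 0 "\<lambda>_. 0"] by (auto simp: m_def)
  then obtain k where k: "m r r = 2 * k" by auto
  have sym: "m a b = m b a" and inv: "m (\<tau> a) (\<tau> b) = m a b" for a b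
    using defect_cocycle[OF c] unfolding cocycle_zero_iff m_def by blast+
  have "m p r = 0" "m q r = 0" "m s s = 0"
    by (simp_all add: m_def defect_def)
  with m k have "\<forall>a b. m a b = (if a = r \<and> b = r then 2 * k else 0)"
    using inv[of p p] inv[of p s] sym[of p q] sym[of p s] sym[of q s] sym[of r s] sym[of p r]
      sym[of q r]
    unfolding all_elements by simp
  then have l: "l a b = pot l a + pot l b - pot l (a \<diamondop>\<^sub>q b) + (if a = r \<and> b = r then 2 * k else 0)"
    for a b
    by (simp add: m_def defect_def algebra_simps)
  define \<phi> where "\<phi> a = (if a = r then k else pot l a)" for a
  have act_r: "a \<lhd>\<^sub>q b = r \<longleftrightarrow> a = r" "r \<lhd>\<^sub>q b = r" for a b
    by (cases "b = r"; auto simp: act tau transpose_eq_iff)+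
  have "\<chi> a b = \<phi> (a \<lhd>\<^sub>q b) - \<phi> a" for a b
    by (subst chi_eq_pot[OF c]) (auto simp: \<phi>_def act_r)
  moreover have "l a b = \<phi> a + \<phi> b - \<phi> (a \<diamondop>\<^sub>q b)" for a b
    by (subst l) (auto simp: \<phi>_def dia_eq_r_iff dia_r(2,3))
  ultimately have "(\<chi>, l) = qualgebra_coboundary (\<lhd>\<^sub>q) (\<diamondop>\<^sub>q) \<phi>"
    by (simp add: qualgebra_coboundary_def fun_eq_iff)
  then show ?thesis by blast
qed

lemma invariants_coboundary:
  "invariants (defect (snd (qualgebra_coboundary (\<lhd>\<^sub>q) (\<diamondop>\<^sub>q) \<phi>))) = (0, \<lambda>i\<in>{..<4}. 0)"
  unfolding invariants_eq_iff by (simp add: qualgebra_coboundary_def defect_coboundary)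

lemma H2_iso: "H2 (\<lhd>\<^sub>q) (\<diamondop>\<^sub>q) \<cong> integer_mod_group 2 \<times>\<times> Z_pow 4"
proof -
  let ?Z = "Z2 (\<lhd>\<^sub>q) (\<diamondop>\<^sub>q)" and ?A = "integer_mod_group 2 \<times>\<times> Z_pow 4"
  let ?h = "\<lambda>c. invariants (defect (snd c))"
  interpret Z: comm_group ?Z by (rule comm_group_Z2)
  have "group ?A"
    by (intro DirProd_group) (simp_all add: Z_pow_def)
  then interpret h: group_hom ?Z ?A ?h
    by (intro group_hom.intro group_hom_axioms.intro Z.is_group invariants_hom)
  have one: "\<one>\<^bsub>?A\<^esub> = (0, \<lambda>i\<in>{..<4}. 0)"
    by (simp add: one_Z_pow)
  have "kernel ?Z ?A ?h = carrier (B2 (\<lhd>\<^sub>q) (\<diamondop>\<^sub>q))"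
  proof
    show "kernel ?Z ?A ?h \<subseteq> carrier (B2 (\<lhd>\<^sub>q) (\<diamondop>\<^sub>q))"
      using coboundary_if_invariants_trivial unfolding kernel_def one by (auto simp: Z2_def B2_def)
    show "carrier (B2 (\<lhd>\<^sub>q) (\<diamondop>\<^sub>q)) \<subseteq> kernel ?Z ?A ?h"
      using coboundary_is_cocycle invariants_coboundary unfolding kernel_def one
      by (auto simp: B2_def)
  qed
  moreover have "?h ` carrier ?Z = carrier ?A"
    using invariants_surj h.hom_closed by blast
  then have "?Z Mod kernel ?Z ?A ?h \<cong> ?A"
    by (rule h.FactGroup_iso)
  ultimately show ?thesis
    by (simp add: H2_def)
qed

end

theorem proposition6p15:
  fixes p q r s :: 'a
    and act :: "'a \<Rightarrow> 'a \<Rightarrow> 'a"  (infixl "\<lhd>\<^sub>q" 70)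
    and dia :: "'a \<Rightarrow> 'a \<Rightarrow> 'a"  (infixl "\<diamondop>\<^sub>q" 70)
    and \<tau> :: "'a \<Rightarrow> 'a"
  assumes "(UNIV :: 'a set) = {p, q, r, s}" and "card {p, q, r, s} = 4"
    and "\<tau> = transpose p q"
    and "\<And>x. x \<lhd>\<^sub>q r = \<tau> x" and "\<And>x y. y \<noteq> r \<Longrightarrow> x \<lhd>\<^sub>q y = x"
    and "r \<diamondop>\<^sub>q r = s"
    and "\<And>x. x \<noteq> r \<Longrightarrow> r \<diamondop>\<^sub>q x = r" and "\<And>x. x \<noteq> r \<Longrightarrow> x \<diamondop>\<^sub>q r = r"
    and "s \<diamondop>\<^sub>q s = s"
    and "q \<diamondop>\<^sub>q s = s \<diamondop>\<^sub>q q" and "q \<diamondop>\<^sub>q s \<in> {p, q, s}"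
    and "p \<diamondop>\<^sub>q s = s \<diamondop>\<^sub>q p" and "p \<diamondop>\<^sub>q s = \<tau> (q \<diamondop>\<^sub>q s)"
    and "p \<diamondop>\<^sub>q q = q \<diamondop>\<^sub>q p" and "p \<diamondop>\<^sub>q q = s"
    and "q \<diamondop>\<^sub>q q \<in> {p, q, s}" and "p \<diamondop>\<^sub>q p = \<tau> (q \<diamondop>\<^sub>q q)"
  shows "B2 (\<lhd>\<^sub>q) (\<diamondop>\<^sub>q) \<cong> Z_pow 4 \<and>
         H2 (\<lhd>\<^sub>q) (\<diamondop>\<^sub>q) \<cong> integer_mod_group 2 \<times>\<times> Z_pow 4"
proof -
  interpret swap_qualgebra p q r s act dia \<tau>
    by (rule swap_qualgebra.intro) (fact assms)+
  show ?thesis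
    using B2_iso H2_iso by blast
qed

end
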